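(* Let $V$ be the vector space with basis $\{v_j\mid j\in\mathbf{Z}\}$ and let $a\in\mathbf{C}^*$. Each of the following four formulas (for all $(m,n)\in\mathbf{Z}^2\setminus\{(0,0)\}$ and $k\in\mathbf{Z}$), extended linearly, defines an action of $L$ on $V$ making $V$ an $L$-module: $\langle 1\rangle$ $(t_1^m t_2^n).v_k=(aq^k)^n v_{k+m}$; $\langle 2\rangle$ $(t_1^m t_2^n).v_k=(-1)^m(aq^k)^n v_{k+m}$; $\langle 3\rangle$ $(t_1^m t_2^n).v_k=(-1)^{m+n+1}(aq^{-k-m})^n v_{k+m}$; $\langle 4\rangle$ $(t_1^m t_2^n).v_k=(-1)^{n+1}(aq^{-k-m})^n v_{k+m}$.
   Context: All vector spaces are over $\mathbf{C}$; $\mathbf{C}^*$ denotes the nonzero complex numbers. Fix $q\in\mathbf{C}$ nonzero and not a root of unity. The centerless $q$-analog Virasoro-like algebra $L$ is the Lie algebra over $\mathbf{C}$ with basis the symbols $t_1^h t_2^j$, $(h,j)\in\mathbf{Z}^2\setminus\{(0,0)\}$, and bracket $[t_1^h t_2^j, t_1^m t_2^n]=(q^{jm}-q^{hn})\,t_1^{h+m}t_2^{j+n}$ (when $(h+m,j+n)=(0,0)$ the coefficient is $0$ and the bracket is $0$). *)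

theory Defs
  imports Complex_Main "HOL-Library.Poly_Mapping"
begin

locale lie_algebra = vector_space scale
  for scale :: "'f::field \<Rightarrow> 'l::ab_group_add \<Rightarrow> 'l" +
  fixes bracket :: "'l \<Rightarrow> 'l \<Rightarrow> 'l"
  assumes linear_bracket_left: "Vector_Spaces.linear scale scale (\<lambda>x. bracket x y)"
    and linear_bracket_right: "Vector_Spaces.linear scale scale (bracket x)"
    and bracket_self: "bracket x x = 0"
    and jacobi: "bracket x (bracket y z) + bracket y (bracket z x) + bracket z (bracket x y) = 0"

locale lie_module = lie_algebra scaleL bracket + V: vector_space scaleV
  for scaleL :: "'f::field \<Rightarrow> 'l::ab_group_add \<Rightarrow> 'l"
    and bracket :: "'l \<Rightarrow> 'l \<Rightarrow> 'l"
    and scaleV :: "'f \<Rightarrow> 'v::ab_group_add \<Rightarrow> 'v" +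
  fixes act :: "'l \<Rightarrow> 'v \<Rightarrow> 'v"
  assumes linear_act_left: "Vector_Spaces.linear scaleL scaleV (\<lambda>x. act x v)"
    and linear_act_right: "Vector_Spaces.linear scaleV scaleV (act x)"
    and act_bracket: "act (bracket x y) v = act x (act y v) - act y (act x v)"

text \<open>
  The complex vector space with basis indexed by a type \<open>'i\<close> is the type of finitely supported
  functions from \<open>'i\<close> to the complex numbers, where \<open>Poly_Mapping.single i 1\<close> is the
  basis vector with index \<open>i\<close>.
\<close>

definition fscale :: "complex \<Rightarrow> ('i \<Rightarrow>\<^sub>0 complex) \<Rightarrow> ('i \<Rightarrow>\<^sub>0 complex)" (infixr "*\<^sub>F" 75)
  where "c *\<^sub>F x = Poly_Mapping.map ((*) c) x"

definition bilinear_extension ::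
    "('i \<Rightarrow> 'j \<Rightarrow> ('k \<Rightarrow>\<^sub>0 complex)) \<Rightarrow> ('i \<Rightarrow>\<^sub>0 complex) \<Rightarrow> ('j \<Rightarrow>\<^sub>0 complex) \<Rightarrow> ('k \<Rightarrow>\<^sub>0 complex)"
  where "bilinear_extension f x y =
    (\<Sum>i\<in>Poly_Mapping.keys x. \<Sum>j\<in>Poly_Mapping.keys y.
       (Poly_Mapping.lookup x i * Poly_Mapping.lookup y j) *\<^sub>F f i j)"

typedef vl_index = "{p :: int \<times> int. p \<noteq> (0, 0)}"
  morphisms vl_pair Vl_index
  by (rule exI[of _ "(1, 0)"]) simp

type_synonym vl_algebra = "vl_index \<Rightarrow>\<^sub>0 complex"

text \<open>
  \<open>vl_t h j\<close> is the basis symbol \<open>t\<^sub>1\<^sup>h t\<^sub>2\<^sup>j\<close>. There is no basis symbol with exponents \<open>(0, 0)\<close>;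
  setting \<open>vl_t 0 0 = 0\<close> makes the bracket formula meaningful (and zero) when the
  exponents of the two factors add up to \<open>(0, 0)\<close>.
\<close>

definition vl_t :: "int \<Rightarrow> int \<Rightarrow> vl_algebra"
  where "vl_t h j = (if (h, j) = (0, 0) then 0 else Poly_Mapping.single (Vl_index (h, j)) 1)"

definition vl_bracket :: "complex \<Rightarrow> vl_algebra \<Rightarrow> vl_algebra \<Rightarrow> vl_algebra"
  where "vl_bracket q = bilinear_extension (\<lambda>r s.
    case (vl_pair r, vl_pair s) of ((h, j), (m, n)) \<Rightarrow>
      (q powi (j * m) - q powi (h * n)) *\<^sub>F vl_t (h + m) (j + n))"

type_synonym v_space = "int \<Rightarrow>\<^sub>0 complex"

definition basis_v :: "int \<Rightarrow> v_space"
  where "basis_v k = Poly_Mapping.single k 1"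

definition vl_action :: "(int \<Rightarrow> int \<Rightarrow> int \<Rightarrow> v_space) \<Rightarrow> vl_algebra \<Rightarrow> v_space \<Rightarrow> v_space"
  where "vl_action f = bilinear_extension (\<lambda>r k. case vl_pair r of (m, n) \<Rightarrow> f m n k)"

abbreviation vl_module :: "complex \<Rightarrow> (vl_algebra \<Rightarrow> v_space \<Rightarrow> v_space) \<Rightarrow> bool"
  where "vl_module q act \<equiv> lie_module (*\<^sub>F) (vl_bracket q) (*\<^sub>F) act"

lemma lookup_fscale [simp]: "Poly_Mapping.lookup (c *\<^sub>F x) i = c * Poly_Mapping.lookup x i"
  by (simp add: fscale_def map.rep_eq when_def)

lemma vector_space_fscale: "vector_space ((*\<^sub>F) :: complex \<Rightarrow> ('i \<Rightarrow>\<^sub>0 complex) \<Rightarrow> _)"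
  by standard (auto intro!: poly_mapping_eqI simp: lookup_add algebra_simps)

lemma bilinear_extension_single [simp]:
  "bilinear_extension f (Poly_Mapping.single i 1) (Poly_Mapping.single j 1) = f i j"
  by (auto intro!: poly_mapping_eqI simp: bilinear_extension_def)

lemma vl_bracket_t:
  assumes "(h, j) \<noteq> (0, 0)" "(m, n) \<noteq> (0, 0)"
  shows "vl_bracket q (vl_t h j) (vl_t m n) =
    (q powi (j * m) - q powi (h * n)) *\<^sub>F vl_t (h + m) (j + n)"
  using assms by (auto simp: vl_bracket_def vl_t_def Vl_index_inverse)

lemma vl_action_t:
  assumes "(m, n) \<noteq> (0, 0)"
  shows "vl_action f (vl_t m n) (basis_v k) = f m n k"
  using assms by (auto simp: vl_action_def vl_t_def basis_v_def Vl_index_inverse)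

end

theory Submission
  imports Defs
begin

text \<open>
  All structures involved are bilinear, so every identity only has to be checked on basis vectors.
  There each one becomes an identity between powers of \<open>q\<close>.

  \<^item> \<^bold>\<open>The algebra.\<close> In the Jacobi identity for three basis symbols all terms are multiples of one
    and the same symbol, and the coefficients are products of two differences. Expanding these
    gives four powers of \<open>q\<close> per cyclic rotation; they cancel in pairs. This is
    \<open>lie_algebra_vl_bracket\<close>.

  \<^item> \<^bold>\<open>The modules.\<close> If \<open>t\<^sub>1\<^sup>m t\<^sub>2\<^sup>n\<close> sends \<open>v\<^sub>k\<close> to \<open>c m n k\<close> times \<open>v\<^bsub>k + m\<^esub>\<close>, then this is an action as
    soon as the scalars \<open>c\<close> satisfy one functional equation (\<open>vl_module_of_coefficients\<close>). The degree
    \<open>(0, 0)\<close>, which is missing from the algebra, does no harm: whenever it occurs as a sum of two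
    degrees, the structure constant vanishes.

  \<^item> \<^bold>\<open>The four formulas.\<close> There are only two computations behind them. The scalars \<open>(a q\<^sup>k)\<^sup>n\<close> say that
    \<open>t\<^sub>1\<close> shifts the basis and \<open>t\<^sub>2\<close> is diagonal, with \<open>t\<^sub>2 t\<^sub>1 = q t\<^sub>1 t\<^sub>2\<close>; the bracket of \<open>L\<close> is the commutator
    in this quantum torus. The scalars \<open>- (b q\<^bsup>- k - m\<^esup>)\<^sup>n\<close> are those of the dual module: \<open>t\<^sub>1\<^sup>m t\<^sub>2\<^sup>n\<close> acts
    by minus its transpose on the dual basis, which is renumbered by \<open>k \<mapsto> - k\<close>. Both families may be
    multiplied by \<open>e\<^sup>m\<close>, because \<open>e\<^sup>m\<close> is multiplicative in the degree (\<open>vl_module_shift\<close> and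
    \<open>vl_module_dual_shift\<close>). The formulas are the instances \<open>e = \<plusminus>1\<close>, where in the last two the
    sign \<open>(-1)\<^sup>n\<close> is absorbed by \<open>b = - a\<close>.
\<close>

section \<open>Bilinear extension from a basis\<close>

interpretation fscale: vector_space "(*\<^sub>F) :: complex \<Rightarrow> ('i \<Rightarrow>\<^sub>0 complex) \<Rightarrow> _"
  by (rule vector_space_fscale)

text \<open>
  This induction reduces identities between multilinear expressions to basis vectors.
\<close>

lemma basis_induct [case_names zero add scale single]:
  fixes x :: "'i \<Rightarrow>\<^sub>0 complex"
  assumes zero: "P 0"
    and add: "\<And>x y. P x \<Longrightarrow> P y \<Longrightarrow> P (x + y)"
    and scale: "\<And>c x. P x \<Longrightarrow> P (c *\<^sub>F x)"
    and single: "\<And>i. P (Poly_Mapping.single i 1)"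
  shows "P x"
proof (induction x rule: update_induct)
  case const
  show ?case by (rule zero)
next
  case (update f a b)
  have "Poly_Mapping.update a b f = f + b *\<^sub>F Poly_Mapping.single a 1"
    using update(1)
    by (auto intro!: poly_mapping_eqI
        simp: lookup_update lookup_add lookup_single when_def in_keys_iff)
  then show ?case
    using add[OF update(3) scale[OF single]] by simp
qed

text \<open>
  The sums defining the extension range over the supports of the arguments. Enlarging them to fixed
  finite sets makes linearity a matter of rearranging sums.
\<close>

lemma bilinear_extension_superset:
  assumes "finite A" "finite B" "Poly_Mapping.keys x \<subseteq> A" "Poly_Mapping.keys y \<subseteq> B"
  shows "bilinear_extension f x y =
    (\<Sum>i\<in>A. \<Sum>j\<in>B. (Poly_Mapping.lookup x i * Poly_Mapping.lookup y j) *\<^sub>F f i j)"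
proof -
  have "bilinear_extension f x y = (\<Sum>i\<in>Poly_Mapping.keys x. \<Sum>j\<in>B.
      (Poly_Mapping.lookup x i * Poly_Mapping.lookup y j) *\<^sub>F f i j)"
    unfolding bilinear_extension_def using assms
    by (intro sum.cong refl sum.mono_neutral_left) (auto simp: in_keys_iff)
  also have "\<dots> = (\<Sum>i\<in>A. \<Sum>j\<in>B.
      (Poly_Mapping.lookup x i * Poly_Mapping.lookup y j) *\<^sub>F f i j)"
    using assms by (intro sum.mono_neutral_left) (auto simp: in_keys_iff)
  finally show ?thesis .
qed

lemma bilinear_extension_add_left:
  "bilinear_extension f (x + x') y = bilinear_extension f x y + bilinear_extension f x' y"
  using Poly_Mapping.keys_add[of x x']
  by (simp add: bilinear_extension_superset
        [where A = "Poly_Mapping.keys x \<union> Poly_Mapping.keys x'" and B = "Poly_Mapping.keys y"]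
      lookup_add distrib_right fscale.scale_left_distrib sum.distrib)

lemma bilinear_extension_add_right:
  "bilinear_extension f x (y + y') = bilinear_extension f x y + bilinear_extension f x y'"
  using Poly_Mapping.keys_add[of y y']
  by (simp add: bilinear_extension_superset
        [where A = "Poly_Mapping.keys x" and B = "Poly_Mapping.keys y \<union> Poly_Mapping.keys y'"]
      lookup_add distrib_left fscale.scale_left_distrib sum.distrib)

lemma keys_fscale_subset: "Poly_Mapping.keys (c *\<^sub>F x) \<subseteq> Poly_Mapping.keys x"
  by (auto simp: in_keys_iff)

lemma bilinear_extension_scale_left:
  "bilinear_extension f (c *\<^sub>F x) y = c *\<^sub>F bilinear_extension f x y"
  using keys_fscale_subset[of c x]
  by (simp add: bilinear_extension_superset
        [where A = "Poly_Mapping.keys x" and B = "Poly_Mapping.keys y"]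
      fscale.scale_sum_right mult_ac)

lemma bilinear_extension_scale_right:
  "bilinear_extension f x (c *\<^sub>F y) = c *\<^sub>F bilinear_extension f x y"
  using keys_fscale_subset[of c y]
  by (simp add: bilinear_extension_superset
        [where A = "Poly_Mapping.keys x" and B = "Poly_Mapping.keys y"]
      fscale.scale_sum_right mult_ac)

lemma bilinear_extension_zero_left: "bilinear_extension f 0 y = 0"
  by (simp add: bilinear_extension_def)

lemma bilinear_extension_zero_right: "bilinear_extension f x 0 = 0"
  by (simp add: bilinear_extension_def)

lemmas bilinear_extension_simps =
  bilinear_extension_add_left bilinear_extension_add_right
  bilinear_extension_scale_left bilinear_extension_scale_right
  bilinear_extension_zero_left bilinear_extension_zero_right

lemma linear_fscaleI:
  fixes f :: "('i \<Rightarrow>\<^sub>0 complex) \<Rightarrow> ('j \<Rightarrow>\<^sub>0 complex)"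
  assumes "\<And>x y. f (x + y) = f x + f y" "\<And>c x. f (c *\<^sub>F x) = c *\<^sub>F f x"
  shows "Vector_Spaces.linear (*\<^sub>F) (*\<^sub>F) f"
  by (intro Vector_Spaces.linear.intro module_hom.intro module_hom_axioms.intro
      vector_space_fscale fscale.module_axioms assms)

lemma linear_bilinear_extension_left:
  "Vector_Spaces.linear (*\<^sub>F) (*\<^sub>F) (\<lambda>x. bilinear_extension f x y)"
  by (rule linear_fscaleI) (simp_all add: bilinear_extension_simps)

lemma linear_bilinear_extension_right:
  "Vector_Spaces.linear (*\<^sub>F) (*\<^sub>F) (bilinear_extension f x)"
  by (rule linear_fscaleI) (simp_all add: bilinear_extension_simps)

section \<open>The Lie algebra\<close>

lemmas vl_bracket_simps =
  bilinear_extension_simps[where f = "\<lambda>r s. case (vl_pair r, vl_pair s) of ((h, j), (m, n)) \<Rightarrow>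
      (q powi (j * m) - q powi (h * n)) *\<^sub>F vl_t (h + m) (j + n)" for q,
    folded vl_bracket_def]

lemma vl_t_zero: "vl_t 0 0 = 0"
  by (simp add: vl_t_def)

lemma vl_induct [case_names add scale symbol]:
  assumes add: "\<And>x y. P x \<Longrightarrow> P y \<Longrightarrow> P (x + y)"
    and scale: "\<And>c x. P x \<Longrightarrow> P (c *\<^sub>F x)"
    and symbol: "\<And>h j. P (vl_t h j)"
  shows "P x"
proof (induction x rule: basis_induct)
  case zero
  show ?case using symbol[of 0 0] by (simp add: vl_t_zero)
next
  case (single i)
  obtain h j where i: "vl_pair i = (h, j)" by fastforce
  then have "(h, j) \<noteq> (0, 0)" using vl_pair[of i] by auto
  then have "vl_t h j = Poly_Mapping.single i 1"
    using i vl_pair_inverse[of i] by (auto simp: vl_t_def)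
  then show ?case using symbol[of h j] by simp
qed (auto intro: add scale)

text \<open>
  The bracket formula persists when a factor has degree \<open>(0, 0)\<close>, because both powers of \<open>q\<close> in the
  structure constant are then \<open>1\<close>. This spares all case distinctions in the Jacobi identity.
\<close>

lemma vl_bracket_symbols:
  "vl_bracket q (vl_t h j) (vl_t m n) =
    (q powi (j * m) - q powi (h * n)) *\<^sub>F vl_t (h + m) (j + n)"
proof (cases "(h, j) = (0, 0) \<or> (m, n) = (0, 0)")
  case True
  then show ?thesis by (auto simp: vl_t_zero vl_bracket_simps)
next
  case False
  then show ?thesis by (intro vl_bracket_t) auto
qed

lemma vl_bracket_antisym: "vl_bracket q x y = - vl_bracket q y x"
proof (induction x rule: vl_induct)
  case (symbol h j)
  show ?case
  proof (induction y rule: vl_induct)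
    case (symbol m n)
    show ?case
      by (simp add: vl_bracket_symbols add.commute mult.commute
          flip: fscale.scale_minus_left)
  qed (simp_all add: vl_bracket_simps)
qed (simp_all add: vl_bracket_simps)

lemma vl_bracket_self: "vl_bracket q x x = 0"
proof (rule poly_mapping_eqI)
  fix i
  have "Poly_Mapping.lookup (vl_bracket q x x) i = - Poly_Mapping.lookup (vl_bracket q x x) i"
    using arg_cong[OF vl_bracket_antisym[of q x x], of "\<lambda>z. Poly_Mapping.lookup z i"] by simp
  then show "Poly_Mapping.lookup (vl_bracket q x x) i = Poly_Mapping.lookup 0 i" by simp
qed

lemma vl_jacobi_symbols:
  assumes "q \<noteq> 0"
  shows "vl_bracket q (vl_t h j) (vl_bracket q (vl_t m n) (vl_t r s)) +
    vl_bracket q (vl_t m n) (vl_bracket q (vl_t r s) (vl_t h j)) +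
    vl_bracket q (vl_t r s) (vl_bracket q (vl_t h j) (vl_t m n)) = 0"
proof -
  let ?t = "vl_t (h + m + r) (j + n + s)"
  have "(q powi (n * r) - q powi (m * s)) * (q powi (j * (m + r)) - q powi (h * (n + s))) +
      (q powi (s * h) - q powi (r * j)) * (q powi (n * (r + h)) - q powi (m * (s + j))) +
      (q powi (j * m) - q powi (h * n)) * (q powi (s * (h + m)) - q powi (r * (j + n))) = 0"
    using assms by (simp add: power_int_add algebra_simps)
  from arg_cong[OF this, of "\<lambda>c. c *\<^sub>F ?t"] show ?thesis
    by (simp add: vl_bracket_symbols vl_bracket_simps fscale.scale_left_distrib add_ac)
qed

lemma vl_jacobi:
  assumes "q \<noteq> 0"
  shows "vl_bracket q x (vl_bracket q y z) + vl_bracket q y (vl_bracket q z x) +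
    vl_bracket q z (vl_bracket q x y) = 0" (is "?J x y z = 0")
proof (induction x rule: vl_induct)
  case (add x x')
  have "?J (x + x') y z = ?J x y z + ?J x' y z" by (simp add: vl_bracket_simps add_ac)
  then show ?case using add by simp
next
  case (scale c x)
  have "?J (c *\<^sub>F x) y z = c *\<^sub>F ?J x y z"
    by (simp add: vl_bracket_simps fscale.scale_right_distrib)
  then show ?case using scale by simp
next
  case (symbol h j)
  show ?case
  proof (induction y rule: vl_induct)
    case (add y y')
    have "?J (vl_t h j) (y + y') z = ?J (vl_t h j) y z + ?J (vl_t h j) y' z"
      by (simp add: vl_bracket_simps add_ac)
    then show ?case using add by simp
  next
    case (scale c y)
    have "?J (vl_t h j) (c *\<^sub>F y) z = c *\<^sub>F ?J (vl_t h j) y z"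
      by (simp add: vl_bracket_simps fscale.scale_right_distrib)
    then show ?case using scale by simp
  next
    case (symbol m n)
    show ?case
    proof (induction z rule: vl_induct)
      case (add z z')
      have "?J (vl_t h j) (vl_t m n) (z + z') =
          ?J (vl_t h j) (vl_t m n) z + ?J (vl_t h j) (vl_t m n) z'"
        by (simp add: vl_bracket_simps add_ac)
      then show ?case using add by simp
    next
      case (scale c z)
      have "?J (vl_t h j) (vl_t m n) (c *\<^sub>F z) = c *\<^sub>F ?J (vl_t h j) (vl_t m n) z"
        by (simp add: vl_bracket_simps fscale.scale_right_distrib)
      then show ?case using scale by simp
    next
      case (symbol r s)
      show ?case by (rule vl_jacobi_symbols[OF assms])
    qed
  qed
qed

lemma lie_algebra_vl_bracket:
  assumes "q \<noteq> 0"
  shows "lie_algebra (*\<^sub>F) (vl_bracket q)"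
  by (intro lie_algebra.intro lie_algebra_axioms.intro vector_space_fscale
      vl_bracket_self vl_jacobi[OF assms])
    (simp_all add: vl_bracket_def linear_bilinear_extension_left linear_bilinear_extension_right)

section \<open>Modules on which every symbol acts as a weighted shift\<close>

lemmas vl_action_simps =
  bilinear_extension_simps[where f = "\<lambda>r k. case vl_pair r of (m, n) \<Rightarrow> f m n k"
      for f :: "int \<Rightarrow> int \<Rightarrow> int \<Rightarrow> v_space",
    folded vl_action_def]

text \<open>
  The hypothesis compares the coefficients of \<open>v\<^bsub>k + h + m\<^esub>\<close> in the commutator of \<open>t\<^sub>1\<^sup>h t\<^sub>2\<^sup>j\<close> and \<open>t\<^sub>1\<^sup>m t\<^sub>2\<^sup>n\<close>,
  applied to \<open>v\<^sub>k\<close>, and in the action of their bracket.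
\<close>

lemma vl_module_of_coefficients:
  fixes c :: "int \<Rightarrow> int \<Rightarrow> int \<Rightarrow> complex"
  assumes "q \<noteq> 0"
    and c: "\<And>h j m n k. c m n k * c h j (k + m) - c h j k * c m n (k + h) =
      (q powi (j * m) - q powi (h * n)) * c (h + m) (j + n) k"
  shows "vl_module q (vl_action (\<lambda>m n k. c m n k *\<^sub>F basis_v (k + m)))"
proof -
  define act where "act = vl_action (\<lambda>m n k. c m n k *\<^sub>F basis_v (k + m))"
  note act_simps = vl_action_simps[where f = "\<lambda>m n k. c m n k *\<^sub>F basis_v (k + m)", folded act_def]
  have act_t: "act (vl_t m n) (basis_v k) = c m n k *\<^sub>F basis_v (k + m)"
    if "(m, n) \<noteq> (0, 0)" for m n k
    unfolding act_def by (rule vl_action_t[OF that])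
  have act_bracket_symbols: "act (vl_bracket q (vl_t h j) (vl_t m n)) (basis_v k) =
      act (vl_t h j) (act (vl_t m n) (basis_v k)) - act (vl_t m n) (act (vl_t h j) (basis_v k))"
    for h j m n k
  proof (cases "(h, j) = (0, 0) \<or> (m, n) = (0, 0)")
    case True
    then show ?thesis by (auto simp: vl_t_zero vl_bracket_simps act_simps)
  next
    case False
    then have nz: "(h, j) \<noteq> (0, 0)" "(m, n) \<noteq> (0, 0)" by auto
    have "act (vl_bracket q (vl_t h j) (vl_t m n)) (basis_v k) =
        ((q powi (j * m) - q powi (h * n)) * c (h + m) (j + n) k) *\<^sub>F basis_v (k + (h + m))"
    proof (cases "(h + m, j + n) = (0, 0)")
      case True
      \<comment> \<open>Opposite degrees: here \<open>jm = hn\<close>, so that the structure constant vanishes.\<close>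
      then have "m = - h" "n = - j" by auto
      then show ?thesis by (simp add: vl_bracket_symbols act_simps vl_t_zero mult.commute)
    next
      case False
      then show ?thesis by (simp add: vl_bracket_symbols act_simps act_t)
    qed
    also have "\<dots> = (c m n k * c h j (k + m) - c h j k * c m n (k + h)) *\<^sub>F basis_v (k + (h + m))"
      by (simp only: c)
    also have "\<dots> =
        act (vl_t h j) (act (vl_t m n) (basis_v k)) - act (vl_t m n) (act (vl_t h j) (basis_v k))"
      using nz by (simp add: act_t act_simps fscale.scale_left_diff_distrib add_ac)
    finally show ?thesis .
  qed
  have act_bracket: "act (vl_bracket q x y) v = act x (act y v) - act y (act x v)" for x y v
  proof (induction x rule: vl_induct)
    case (symbol h j)
    show ?case
    proof (induction y rule: vl_induct)
      case (symbol m n)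
      show ?case
      proof (induction v rule: basis_induct)
        case (single k)
        show ?case using act_bracket_symbols[of h j m n k] by (simp add: basis_v_def)
      qed (simp_all add: act_simps fscale.scale_right_diff_distrib)
    qed (simp_all add: act_simps vl_bracket_simps fscale.scale_right_diff_distrib)
  qed (simp_all add: act_simps vl_bracket_simps fscale.scale_right_diff_distrib)
  have "vl_module q act"
  proof (intro lie_module.intro lie_module_axioms.intro
      lie_algebra_vl_bracket[OF assms(1)] vector_space_fscale act_bracket)
    show "Vector_Spaces.linear (*\<^sub>F) (*\<^sub>F) (\<lambda>x. act x v)" for v
      by (simp add: act_def vl_action_def linear_bilinear_extension_left)
    show "Vector_Spaces.linear (*\<^sub>F) (*\<^sub>F) (act x)" for x
      by (simp add: act_def vl_action_def linear_bilinear_extension_right)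
  qed
  then show ?thesis by (simp add: act_def)
qed

text \<open>
  Applying \<open>t\<^sub>1\<^sup>m t\<^sub>2\<^sup>n\<close> and then \<open>t\<^sub>1\<^sup>h t\<^sub>2\<^sup>j\<close> gives the coefficient in degree \<open>(h + m, j + n)\<close> times \<open>q\<^bsup>jm\<^esup>\<close>; the
  opposite order gives \<open>q\<^bsup>hn\<^esup>\<close>.
\<close>

lemma vl_module_shift:
  fixes q a e :: complex
  assumes "q \<noteq> 0" "a \<noteq> 0" "e \<noteq> 0"
  shows "vl_module q (vl_action (\<lambda>m n k. (e powi m * (a * q powi k) powi n) *\<^sub>F basis_v (k + m)))"
proof (rule vl_module_of_coefficients)
  fix h j m n k :: int
  have P: "(a * q powi l) powi i = a powi i * q powi (l * i)" for l i :: int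
    by (simp add: power_int_mult_distrib power_int_mult)
  show "e powi m * (a * q powi k) powi n * (e powi h * (a * q powi (k + m)) powi j) -
      e powi h * (a * q powi k) powi j * (e powi m * (a * q powi (k + h)) powi n) =
    (q powi (j * m) - q powi (h * n)) * (e powi (h + m) * (a * q powi k) powi (j + n))"
    unfolding P using assms by (simp add: power_int_add algebra_simps)
qed (fact assms)

text \<open>
  Here the coefficient in degree \<open>(h + m, j + n)\<close> gets the factor \<open>- q\<^bsup>hn\<^esup>\<close> when \<open>t\<^sub>1\<^sup>m t\<^sub>2\<^sup>n\<close> is applied first,
  and \<open>- q\<^bsup>jm\<^esup>\<close> in the opposite order: the two orders are interchanged, and the sign of the
  coefficients, which is squared in a product but not in the coefficient itself, corrects this.
\<close>

lemma vl_module_dual_shift: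
  fixes q b e :: complex
  assumes "q \<noteq> 0" "b \<noteq> 0" "e \<noteq> 0"
  shows "vl_module q
    (vl_action (\<lambda>m n k. (- (e powi m) * (b * q powi (- k - m)) powi n) *\<^sub>F basis_v (k + m)))"
proof (rule vl_module_of_coefficients)
  fix h j m n k :: int
  have P: "(b * q powi l) powi i = b powi i * q powi (l * i)" for l i :: int
    by (simp add: power_int_mult_distrib power_int_mult)
  \<comment> \<open>The power of \<open>q\<close> that the bracket's action contributes; both products differ from it only by
    a term of the structure constant.\<close>
  define E where "E = q powi ((- k - (h + m)) * (j + n))"
  have E1: "q powi ((- k - m) * n) * q powi ((- (k + m) - h) * j) = E * q powi (h * n)"
    and E2: "q powi ((- k - h) * j) * q powi ((- (k + h) - m) * n) = E * q powi (j * m)"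
    unfolding E_def power_int_add[OF disjI1[OF assms(1)], symmetric]
    by (rule arg_cong[where f = "(powi) q"], simp add: algebra_simps)+
  define B where "B = e powi (h + m) * b powi (j + n)"
  have B: "e powi m * b powi n * (e powi h * b powi j) = B"
    unfolding B_def using assms by (simp add: power_int_add)
  have "- (e powi m) * (b * q powi (- k - m)) powi n *
      (- (e powi h) * (b * q powi (- (k + m) - h)) powi j) -
    - (e powi h) * (b * q powi (- k - h)) powi j *
      (- (e powi m) * (b * q powi (- (k + h) - m)) powi n) =
    (e powi m * b powi n * (e powi h * b powi j)) *
      (q powi ((- k - m) * n) * q powi ((- (k + m) - h) * j) -
       q powi ((- k - h) * j) * q powi ((- (k + h) - m) * n))"
    unfolding P by (simp only: algebra_simps mult_minus_left mult_minus_right minus_minus)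
  also have "\<dots> = (q powi (j * m) - q powi (h * n)) * (- (B * E))"
    unfolding E1 E2 B by (simp add: algebra_simps)
  also have "- (B * E) = - (e powi (h + m)) * (b * q powi (- k - (h + m))) powi (j + n)"
    unfolding P B_def E_def by simp
  finally show "- (e powi m) * (b * q powi (- k - m)) powi n *
      (- (e powi h) * (b * q powi (- (k + m) - h)) powi j) -
    - (e powi h) * (b * q powi (- k - h)) powi j *
      (- (e powi m) * (b * q powi (- (k + h) - m)) powi n) =
    (q powi (j * m) - q powi (h * n)) *
      (- (e powi (h + m)) * (b * q powi (- k - (h + m))) powi (j + n))" .
qed (fact assms)

theorem proposition2p1:
  fixes q a :: complex
  assumes q_nonzero: "q \<noteq> 0"
    and q_not_root_of_unity: "\<forall>N::nat. N > 0 \<longrightarrow> q ^ N \<noteq> 1"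
    and a_nonzero: "a \<noteq> 0"
  shows "vl_module q (vl_action (\<lambda>m n k.
           (a * q powi k) powi n *\<^sub>F basis_v (k + m))) \<and>
         vl_module q (vl_action (\<lambda>m n k.
           ((-1) powi m * (a * q powi k) powi n) *\<^sub>F basis_v (k + m))) \<and>
         vl_module q (vl_action (\<lambda>m n k.
           ((-1) powi (m + n + 1) * (a * q powi (- k - m)) powi n) *\<^sub>F basis_v (k + m))) \<and>
         vl_module q (vl_action (\<lambda>m n k.
           ((-1) powi (n + 1) * (a * q powi (- k - m)) powi n) *\<^sub>F basis_v (k + m)))"
proof -
  have sign: "(-1) powi (n + 1) * (a * x) powi n = - ((- a * x) powi n)" for x :: complex and n
    by (simp add: power_int_add flip: power_int_mult_distrib)
  have third: "(-1) powi (m + n + 1) * (a * x) powi n = - ((-1) powi m) * (- a * x) powi n"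
    for x :: complex and m n
  proof -
    have "(-1) powi (m + n + 1) = (-1) powi m * (-1 :: complex) powi (n + 1)"
      by (simp add: power_int_add)
    then show ?thesis using sign[of n x] by (simp add: mult.assoc)
  qed
  show ?thesis
    unfolding third sign
    using vl_module_shift[OF q_nonzero a_nonzero, of 1]
      vl_module_shift[OF q_nonzero a_nonzero, of "-1"]
      vl_module_dual_shift[OF q_nonzero, of "- a" "-1"]
      vl_module_dual_shift[OF q_nonzero, of "- a" 1] a_nonzero
    by simp
qed

end
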